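(* In the semigroup $({\mathcal P}_f(\mathbb N),\cup)$, let ${\mathcal A}=\{X\in{\mathcal P}_f(\mathbb N):1\notin X\}$. Then $d({\mathcal A})=0$, but there is a F\o lner sequence $\langle{\mathcal F}_n\rangle_{n\in\mathbb N}$ in ${\mathcal P}_f({\mathcal P}_f(\mathbb N))$ such that $$\lim_{n\to\infty}\max_{T\in{\mathcal P}_f(\mathbb N)}\frac{|{\mathcal A}\cap\{Z\cup T:Z\in{\mathcal F}_n\}|}{|\{Z\cup T:Z\in{\mathcal F}_n\}|}=\frac12.$$
   Context: ${\mathcal P}_f(X)$ is the set of finite nonempty subsets of $X$; $\mathbb N=\{1,2,\dots\}$. $({\mathcal P}_f(\mathbb N),\cup)$ is commutative and satisfies the Strong F\o lner Condition. For a semigroup $S$, a F\o lner sequence is a sequence $\langle F_n\rangle$ in ${\mathcal P}_f(S)$ with $\lim_n|F_n\setminus sF_n|/|F_n|=0$ for all $s\in S$. $d(A)$ is the supremum of $\alpha\in[0,1]$ such that for every $H\in{\mathcal P}_f(S)$ and $\epsilon>0$ there is $K\in{\mathcal P}_f(S)$ with $|K\setminus sK|<\epsilon|K|$ for all $s\in H$ and $|A\cap K|\ge\alpha|K|$. *)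

theory Defs
  imports Complex_Main
begin

definition fin_subsets :: "'a set \<Rightarrow> 'a set set"
  where "fin_subsets X = {A. A \<subseteq> X \<and> finite A \<and> A \<noteq> {}}"

text \<open>The natural numbers here start at 1.\<close>

abbreviation pos_nats :: "nat set"
  where "pos_nats \<equiv> {1..}"

text \<open>A semigroup is given by a carrier \<open>S\<close> and an operation \<open>m\<close>, so that
  the left translate of \<open>F\<close> by \<open>s\<close> is \<open>m s ` F\<close>.\<close>

definition folner_sequence ::
    "'a set \<Rightarrow> ('a \<Rightarrow> 'a \<Rightarrow> 'a) \<Rightarrow> (nat \<Rightarrow> 'a set) \<Rightarrow> bool"
  where "folner_sequence S m F \<longleftrightarrow>
    (\<forall>n\<in>pos_nats. F n \<in> fin_subsets S) \<and>
    (\<forall>s\<in>S. (\<lambda>n. real (card (F n - m s ` F n)) / real (card (F n))) \<longlonglongrightarrow> 0)"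

text \<open>The supremum is over a nonempty set exactly when \<open>S\<close> satisfies the Strong
  Folner Condition (the case \<open>\<alpha> = 0\<close>); otherwise the value is unspecified.\<close>

definition folner_density :: "'a set \<Rightarrow> ('a \<Rightarrow> 'a \<Rightarrow> 'a) \<Rightarrow> 'a set \<Rightarrow> real"
  where "folner_density S m A = Sup {\<alpha>. 0 \<le> \<alpha> \<and> \<alpha> \<le> 1 \<and>
    (\<forall>H\<in>fin_subsets S. \<forall>\<epsilon>>0. \<exists>K\<in>fin_subsets S.
       (\<forall>s\<in>H. real (card (K - m s ` K)) < \<epsilon> * real (card K)) \<and>
       real (card (A \<inter> K)) \<ge> \<alpha> * real (card K))}"

definition translate_ratio :: "'a set set \<Rightarrow> 'a set set \<Rightarrow> 'a set \<Rightarrow> real"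
  where "translate_ratio A F T =
    real (card (A \<inter> {Z \<union> T |Z. Z \<in> F})) / real (card {Z \<union> T |Z. Z \<in> F})"

text \<open>For finite \<open>F\<close> only finitely many ratios occur, so \<open>Max\<close> applied to the set
  of all of them is a genuine maximum.\<close>

lemma finite_translate_ratios:
  assumes "finite F"
  shows "finite (translate_ratio A F ` X)"
proof (rule finite_subset)
  let ?R = "(\<lambda>(a, b). real a / real b) ` ({..card F} \<times> {..card F})"
  show "translate_ratio A F ` X \<subseteq> ?R"
  proof
    fix r assume "r \<in> translate_ratio A F ` X"
    then obtain T where r: "r = translate_ratio A F T" by blast
    let ?G = "(\<lambda>Z. Z \<union> T) ` F"
    have G: "{Z \<union> T |Z. Z \<in> F} = ?G" by blast
    have b: "card ?G \<le> card F" using assms by (rule card_image_le)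
    have "card (A \<inter> ?G) \<le> card ?G" using assms by (intro card_mono) auto
    with b have "(card (A \<inter> ?G), card ?G) \<in> {..card F} \<times> {..card F}" by simp
    then show "r \<in> ?R" unfolding r translate_ratio_def G by (rule rev_image_eqI) simp
  qed
  show "finite ?R" by simp
qed

end

theory Submission
  imports Defs
begin

text \<open>A member \<open>Z\<close> of \<open>K\<close> with \<open>s \<subseteq> Z\<close> satisfies \<open>Z = s \<union> Z\<close>, so \<open>K\<close> minus its
  translate by \<open>s\<close> consists precisely of the members of \<open>K\<close> that do not contain \<open>s\<close>. Hence a set
  that is almost invariant under translation by \<open>{1}\<close> has few members avoiding \<open>1\<close>, which gives
  density \<open>0\<close>. For the second part, take the \<open>n + 1\<close> intervals \<open>{1..n + 1}, \<dots>, {1..2 n + 1}\<close>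
  together with the single set \<open>{2}\<close>, which becomes negligible as \<open>n\<close> grows. Translation by
  \<open>{2..2 n + 2}\<close> collapses all intervals to one set and thus leaves two sets, exactly one of which
  avoids \<open>1\<close>; no translate does better, since only the image of \<open>{2}\<close> can avoid \<open>1\<close>.\<close>

lemma diff_Un_translate: "K - (\<union>) s ` K = {Z \<in> K. \<not> s \<subseteq> Z}"
  by (auto simp: Un_absorb1 intro: rev_image_eqI)

lemma Union_in_fin_subsets:
  assumes "H \<in> fin_subsets (fin_subsets X)"
  shows "\<Union>H \<in> fin_subsets X"
  using assms unfolding fin_subsets_def by fast

lemma folner_density_avoiding_eq_0:
  assumes "x \<in> X"
  shows "folner_density (fin_subsets X) (\<union>) {Z \<in> fin_subsets X. x \<notin> Z} = 0"
proof -
  let ?S = "fin_subsets X" and ?A = "{Z \<in> fin_subsets X. x \<notin> Z}"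
  let ?good = "\<lambda>\<alpha>::real. 0 \<le> \<alpha> \<and> \<alpha> \<le> 1 \<and>
    (\<forall>H\<in>fin_subsets ?S. \<forall>\<epsilon>>0. \<exists>K\<in>fin_subsets ?S.
       (\<forall>s\<in>H. real (card (K - (\<union>) s ` K)) < \<epsilon> * real (card K)) \<and>
       real (card (?A \<inter> K)) \<ge> \<alpha> * real (card K))"
  have "\<alpha> = 0" if good: "?good \<alpha>" for \<alpha>
  proof (rule ccontr)
    assume "\<alpha> \<noteq> 0"
    with good have "\<alpha> > 0" by simp
    moreover have "{{x}} \<in> fin_subsets ?S" using assms by (simp add: fin_subsets_def)
    \<comment> \<open>The choice \<open>\<epsilon> = \<alpha>\<close> makes the two bounds clash:
      the members of \<open>K\<close> avoiding \<open>x\<close> number both less than and at least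
      \<open>\<alpha> * card K\<close>.\<close>
    ultimately have "\<exists>K\<in>fin_subsets ?S.
       (\<forall>s\<in>{{x}}. real (card (K - (\<union>) s ` K)) < \<alpha> * real (card K)) \<and>
       real (card (?A \<inter> K)) \<ge> \<alpha> * real (card K)"
      using good by blast
    then obtain K where K: "K \<in> fin_subsets ?S"
      and small: "real (card (K - (\<union>) {x} ` K)) < \<alpha> * real (card K)"
      and large: "\<alpha> * real (card K) \<le> real (card (?A \<inter> K))"
      by auto
    have "?A \<inter> K = K - (\<union>) {x} ` K"
      using K unfolding diff_Un_translate by (auto simp: fin_subsets_def)
    with small large show False by simp
  qed
  \<comment> \<open>This keeps the supremum from ranging over the empty set. The one-element family
    \<open>{\<Union>H}\<close> is fixed by every \<open>s \<in> H\<close>, as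
    \<open>s \<subseteq> \<Union>H\<close>.\<close>
  moreover have "?good 0"
  proof -
    have "\<exists>K\<in>fin_subsets ?S. (\<forall>s\<in>H. real (card (K - (\<union>) s ` K)) < \<epsilon> * real (card K)) \<and>
        real (card (?A \<inter> K)) \<ge> 0 * real (card K)"
      if H: "H \<in> fin_subsets ?S" and "\<epsilon> > 0" for H and \<epsilon> :: real
    proof (intro bexI conjI ballI)
      show "{\<Union>H} \<in> fin_subsets ?S"
        using Union_in_fin_subsets[OF H] by (simp add: fin_subsets_def)
      fix s assume "s \<in> H"
      then have no: "{\<Union>H} - (\<union>) s ` {\<Union>H} = {}" by auto
      show "real (card ({\<Union>H} - (\<union>) s ` {\<Union>H})) < \<epsilon> * real (card {\<Union>H})"
        unfolding no using \<open>\<epsilon> > 0\<close> by simp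
    qed simp
    then show ?thesis by simp
  qed
  ultimately have "{\<alpha>. ?good \<alpha>} = {0}" by blast
  then show ?thesis unfolding folner_density_def by simp
qed

definition interval_family :: "nat \<Rightarrow> nat set set"
  where "interval_family n = insert {2} ((\<lambda>k. {1..Suc (n + k)}) ` {..n})"

lemma finite_interval_family: "finite (interval_family n)"
  by (simp add: interval_family_def)

lemma card_interval_family: "card (interval_family n) = n + 2"
proof -
  have "inj_on (\<lambda>k. {1..Suc (n + k)}) {..n}"
    by (auto simp: inj_on_def)
  moreover have "{2} \<notin> (\<lambda>k. {1..Suc (n + k)}) ` {..n}"
    by (auto simp: image_iff eq_commute[of "{2}"] atLeastAtMost_singleton_iff)
  ultimately show ?thesis
    by (simp add: interval_family_def card_image)
qed

lemma interval_family_in_fin_subsets: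
  "interval_family n \<in> fin_subsets (fin_subsets pos_nats)"
  by (auto simp: interval_family_def fin_subsets_def)

lemma folner_sequence_interval_family:
  "folner_sequence (fin_subsets pos_nats) (\<union>) interval_family"
  unfolding folner_sequence_def
proof (intro conjI ballI)
  fix s :: "nat set" assume s: "s \<in> fin_subsets pos_nats"
  let ?q = "\<lambda>n. real (card (interval_family n - (\<union>) s ` interval_family n))
    / real (card (interval_family n))"
  \<comment> \<open>Once \<open>n\<close> exceeds every element of \<open>s\<close>, even the
    shortest interval \<open>{1..Suc n}\<close> contains \<open>s\<close>, so at most
    \<open>{2}\<close> is lost among \<open>n + 2\<close> sets.\<close>
  have bound: "?q n \<le> 1 / real n" if "n \<ge> Suc (Max s)" for n
  proof -
    have "s \<subseteq> {1..n}"
      using s that by (force simp: fin_subsets_def dest: Max_ge)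
    then have "{Z \<in> interval_family n. \<not> s \<subseteq> Z} \<subseteq> {{2}}"
      by (force simp: interval_family_def)
    then have "card {Z \<in> interval_family n. \<not> s \<subseteq> Z} \<le> 1"
      using card_mono[of "{{2}}" "{Z \<in> interval_family n. \<not> s \<subseteq> Z}"] by simp
    then have "?q n \<le> 1 / real (n + 2)"
      unfolding diff_Un_translate card_interval_family by (intro divide_right_mono) auto
    also have "\<dots> \<le> 1 / real n" using that by (intro divide_left_mono) auto
    finally show ?thesis by simp
  qed
  show "?q \<longlonglongrightarrow> 0"
    by (rule tendsto_sandwich[OF _ eventually_sequentiallyI[OF bound] tendsto_const lim_1_over_n])
      (assumption | simp)+
qed (rule interval_family_in_fin_subsets)

text \<open>At most one set in the translate avoids 1, and the image of an interval is a further
  set, containing 1. A count of one thus comes with at least two sets in total.\<close>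

lemma translate_ratio_interval_family_le:
  "translate_ratio {X \<in> fin_subsets pos_nats. 1 \<notin> X} (interval_family n) T \<le> 1 / 2"
proof -
  let ?A = "{X \<in> fin_subsets pos_nats. 1 \<notin> X}"
  let ?G = "{Z \<union> T |Z. Z \<in> interval_family n}"
  have fin: "finite ?G" using finite_interval_family by simp
  have sub: "?A \<inter> ?G \<subseteq> {{2} \<union> T}"
    by (auto simp: interval_family_def)
  have le1: "card (?A \<inter> ?G) \<le> 1"
    using card_mono[OF _ sub] by simp
  have "{1..Suc n} \<in> interval_family n"
    unfolding interval_family_def by (intro insertI2 image_eqI[of _ _ 0]) simp_all
  then have "{1..Suc n} \<union> T \<in> ?G" by blast
  moreover have "{1..Suc n} \<union> T \<notin> ?A" by simp
  moreover have "A \<inter> G \<subset> G" if "W \<in> G" "W \<notin> A" for A G :: "nat set set" and W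
    using that by blast
  ultimately have "card (?A \<inter> ?G) < card ?G"
    by (intro psubset_card_mono[OF fin])
  then show ?thesis
    using le1 unfolding translate_ratio_def by (simp add: field_simps)
qed

text \<open>The translating set already contains 2 and everything above 1 in the intervals, so an
  interval contributes only the element 1.\<close>

lemma translate_ratio_interval_family_eq:
  "translate_ratio {X \<in> fin_subsets pos_nats. 1 \<notin> X} (interval_family n) {2..2 * n + 2} = 1 / 2"
proof -
  let ?A = "{X \<in> fin_subsets pos_nats. 1 \<notin> X}" and ?T = "{2..2 * n + 2}"
  have "{2} \<union> ?T = ?T" by auto
  moreover have "{1..Suc (n + k)} \<union> ?T = {1..2 * n + 2}" if "k \<le> n" for k
    using that by auto
  moreover have "{Z \<union> ?T |Z. Z \<in> interval_family n} = (\<lambda>Z. Z \<union> ?T) ` interval_family n"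
    by blast
  ultimately have G: "{Z \<union> ?T |Z. Z \<in> interval_family n} = {?T, {1..2 * n + 2}}"
    by (simp add: interval_family_def image_image image_constant_conv del: One_nat_def)
  have "?A \<inter> {?T, {1..2 * n + 2}} = {?T}" by (auto simp: fin_subsets_def)
  moreover have "1 \<notin> ?T" "1 \<in> {1..2 * n + 2}" by auto
  then have "?T \<noteq> {1..2 * n + 2}" by blast
  ultimately show ?thesis unfolding translate_ratio_def G by simp
qed

lemma Max_translate_ratio_interval_family:
  "Max (translate_ratio {X \<in> fin_subsets pos_nats. 1 \<notin> X} (interval_family n) `
     fin_subsets pos_nats) = 1 / 2"
proof (rule Max_eqI)
  \<comment> \<open>The intervals end by \<open>2 * n + 1\<close>, but stopping there would give the
    empty set for \<open>n = 0\<close>.\<close>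
  have "{2..2 * n + 2} \<in> fin_subsets pos_nats" by (auto simp: fin_subsets_def)
  then show "1 / 2 \<in> translate_ratio {X \<in> fin_subsets pos_nats. 1 \<notin> X} (interval_family n) `
      fin_subsets pos_nats"
    by (rule rev_image_eqI) (rule translate_ratio_interval_family_eq[symmetric])
qed (use translate_ratio_interval_family_le in
    \<open>auto intro: finite_translate_ratios finite_interval_family\<close>)

theorem theorem5p6:
  fixes \<A> :: "nat set set"
  defines "\<A> \<equiv> {X \<in> fin_subsets pos_nats. 1 \<notin> X}"
  shows "folner_density (fin_subsets pos_nats) (\<union>) \<A> = 0 \<and>
    (\<exists>\<F> :: nat \<Rightarrow> nat set set.
       folner_sequence (fin_subsets pos_nats) (\<union>) \<F> \<and>
       (\<lambda>n. Max (translate_ratio \<A> (\<F> n) ` fin_subsets pos_nats))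
         \<longlonglongrightarrow> 1 / 2)"
proof (intro conjI exI)
  show "folner_density (fin_subsets pos_nats) (\<union>) \<A> = 0"
    unfolding \<A>_def by (rule folner_density_avoiding_eq_0) simp
  show "folner_sequence (fin_subsets pos_nats) (\<union>) interval_family"
    by (rule folner_sequence_interval_family)
  show "(\<lambda>n. Max (translate_ratio \<A> (interval_family n) ` fin_subsets pos_nats))
      \<longlonglongrightarrow> 1 / 2"
    \<comment> \<open>The maximum equals 1/2 for every \<open>n\<close>, so the sequence is
      constant.\<close>
    unfolding \<A>_def Max_translate_ratio_interval_family by (rule tendsto_const)
qed

end
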